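(* Consider a sequence of networks $G_0, G_1, G_2, \dots$, where $G_0$ is the empty network (no nodes) and, at each step $k \ge 1$, exactly two new nodes arrive, so $N_k = N_{k-1} + 2 = 2k$. The nodes are maintained in two halves $A$ and $B$, and the nodes of each half are ordered by arrival time (the "first" node of a half is the earliest arrived one). At step $k$: (i) one new node $a_k$ is added to $A$ and the other new node $b_k$ is added to $B$; (ii) $a_k$ is linked to all other nodes of $A$ and $b_k$ is linked to all other nodes of $B$; (iii) $a_k$ and $b_k$ are linked to each other; (iv) $a_k$ is linked to the first node of $B$ and $b_k$ is linked to the first node of $A$ (if not already linked); no links are removed. Then $G_i$ is a subnetwork of $G_j$ for all $i \le j$, and for every $k \ge 1$ the network $G_k$ is $N_k/2$-robust and its number of links $L_k$ satisfies $L_k \le \frac{N_k^2}{4} + N_k - 2$.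
   Context: A network is a finite simple undirected graph; links are edges. For an integer $N_f$, a network $G$ is $N_f$-robust if for every set $S$ of $N_f$ nodes of $G$, the network obtained by deleting the nodes of $S$ and their incident links is connected (a network with a single node counts as connected). *)

theory Defs
  imports Complex_Main "Graph_Theory.Digraph_Component"
begin

text \<open>
  Networks are values of type \<open>'v pair_pre_digraph\<close> satisfying \<^const>\<open>pair_graph\<close>: finite, loop-free,
  without parallel arcs, and symmetric. An undirected link is represented by its two opposite
  arcs, so links are counted as unordered pairs and not as arcs.
\<close>

definition links :: "'v pair_pre_digraph \<Rightarrow> 'v set set" where
  "links G = {{u, v} | u v. (u, v) \<in> parcs G}"

definition robust :: "nat \<Rightarrow> 'v pair_pre_digraph \<Rightarrow> bool" where
  "robust Nf G \<longleftrightarrow> (\<forall>S \<subseteq> pverts G. card S = Nf \<longrightarrow>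
     Digraph_Component.connected (with_proj G \<restriction> (pverts G - S)))"

text \<open>The two halves are lists in order of arrival, so the first node of a half is its \<^const>\<open>hd\<close>.\<close>

record 'v growth_state =
  net :: "'v pair_pre_digraph"
  half_A :: "'v list"
  half_B :: "'v list"

definition empty_state :: "'v growth_state" where
  "empty_state = \<lparr>net = \<lparr>pverts = {}, parcs = {}\<rparr>, half_A = [], half_B = []\<rparr>"

definition link :: "'v \<Rightarrow> 'v \<Rightarrow> 'v rel" where
  "link u v = {(u, v), (v, u)}"

text \<open>
  The first nodes are those of the halves with the new nodes already added. In the first step they
  are the new nodes themselves, and the last two links below coincide with \<open>link x y\<close>.
\<close>

definition arrive :: "'v \<Rightarrow> 'v \<Rightarrow> 'v growth_state \<Rightarrow> 'v growth_state" where
  "arrive x y s =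
     (let A = half_A s @ [x]; B = half_B s @ [y] in
      \<lparr>net = \<lparr>pverts = pverts (net s) \<union> {x, y},
              parcs = parcs (net s)
                \<union> (\<Union>u \<in> set A - {x}. link x u) \<union> (\<Union>u \<in> set B - {y}. link y u)
                \<union> link x y
                \<union> link x (hd B) \<union> link y (hd A)\<rparr>,
       half_A = A, half_B = B\<rparr>)"

definition network_growth :: "(nat \<Rightarrow> 'v growth_state) \<Rightarrow> bool" where
  "network_growth s \<longleftrightarrow> s 0 = empty_state \<and>
     (\<forall>k \<ge> 1. \<exists>x y. x \<notin> pverts (net (s (k - 1))) \<and> y \<notin> pverts (net (s (k - 1))) \<and> x \<noteq> y \<and>
        s k = arrive x y (s (k - 1)))"

end

theory Submission
  imports Defs
begin

text \<open>
  Each half is a clique, so a set of surviving nodes is connected as soon as it lies in one half or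
  contains some link between the halves. Deleting half of the nodes leaves \<open>k\<close> of the \<open>2k\<close> nodes. If
  no pair \<open>a\<^sub>i, b\<^sub>i\<close> survives entirely, then by counting exactly one node of each pair survives; in
  particular \<open>a\<^sub>1\<close> or \<open>b\<^sub>1\<close> does, and each of these is linked to the whole opposite half. For the
  count, step \<open>k + 1\<close> adds at most \<open>2k\<close> links inside the halves and three between them (one if
  \<open>k = 0\<close>).
\<close>

text \<open>\<open>connected\<close> means strong connectivity of the symmetric closure, which also
  demands a nonempty vertex set. One arc from \<open>P\<close> to \<open>Q\<close> therefore serves
  in both directions: any path between the sets goes to one end of the bridge, across it, and on
  from the other end.\<close>

lemma connected_two_cliques:
  assumes wf: "pair_wf_digraph G"
    and ne: "P \<union> Q \<noteq> {}"
    and P: "\<And>u v. u \<in> P \<Longrightarrow> v \<in> P \<Longrightarrow> u \<noteq> v \<Longrightarrow> (u, v) \<in> parcs G"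
    and Q: "\<And>u v. u \<in> Q \<Longrightarrow> v \<in> Q \<Longrightarrow> u \<noteq> v \<Longrightarrow> (u, v) \<in> parcs G"
    and bridge: "P = {} \<or> Q = {} \<or> (\<exists>p\<in>P. \<exists>q\<in>Q. (p, q) \<in> parcs G)"
  shows "Digraph_Component.connected (with_proj G \<restriction> (P \<union> Q))"
proof -
  let ?H = "with_proj G \<restriction> (P \<union> Q)"
  let ?M = "with_proj (mk_symmetric ?H)"
  interpret G: pair_wf_digraph G by (rule wf)
  interpret H: wf_digraph ?H by (rule G.wellformed_induce_subgraph)
  interpret M: pair_wf_digraph "mk_symmetric ?H" by (rule H.wellformed_mk_symmetric)
  have adj: "(u, v) \<in> parcs (mk_symmetric ?H) \<and> (v, u) \<in> parcs (mk_symmetric ?H)"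
    if "(u, v) \<in> parcs G" "u \<in> P \<union> Q" "v \<in> P \<union> Q" for u v
    using that by (force simp: parcs_mk_symmetric)
  have within: "u \<rightarrow>\<^sup>*\<^bsub>?M\<^esub> v" if "u \<in> P \<and> v \<in> P \<or> u \<in> Q \<and> v \<in> Q" for u v
  \<comment> \<open>The clique hypotheses give no loops, so this case rests on reflexivity of
    reachability at a vertex.\<close>
  proof (cases "u = v")
    case True
    then show ?thesis using that by auto
  next
    case False
    then show ?thesis using that P Q adj by (intro M.reachable_adjI) blast
  qed
  have across: "u \<rightarrow>\<^sup>*\<^bsub>?M\<^esub> v \<and> v \<rightarrow>\<^sup>*\<^bsub>?M\<^esub> u" if uv: "u \<in> P" "v \<in> Q" for u v
  proof -
    obtain p q where pq: "p \<in> P" "q \<in> Q" "(p, q) \<in> parcs G" using bridge uv by blast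
    then have "p \<rightarrow>\<^sup>*\<^bsub>?M\<^esub> q" "q \<rightarrow>\<^sup>*\<^bsub>?M\<^esub> p" using adj by (blast intro: M.reachable_adjI)+
    moreover have "u \<rightarrow>\<^sup>*\<^bsub>?M\<^esub> p" "p \<rightarrow>\<^sup>*\<^bsub>?M\<^esub> u" "q \<rightarrow>\<^sup>*\<^bsub>?M\<^esub> v" "v \<rightarrow>\<^sup>*\<^bsub>?M\<^esub> q"
      using within pq uv by blast+
    ultimately show ?thesis by (blast intro: M.reachable_trans)
  qed
  show ?thesis unfolding connected_def
    using ne within across by (intro strongly_connectedI) auto
qed

lemma finite_links: "finite (parcs G) \<Longrightarrow> finite (links G)"
  by (rule finite_subset[of _ "(\<lambda>(u, v). {u, v}) ` parcs G"]) (auto simp: links_def)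

text \<open>Indices start at 0: \<open>a k\<close> and \<open>b k\<close> arrive in step
  \<open>k + 1\<close>, and the first nodes of the halves are \<open>a 0\<close> and
  \<open>b 0\<close>.\<close>

locale growth_run =
  fixes s :: "nat \<Rightarrow> 'v growth_state" and a b :: "nat \<Rightarrow> 'v"
  assumes start: "s 0 = empty_state"
    and step: "\<And>k. s (Suc k) = arrive (a k) (b k) (s k)"
    and a_fresh: "\<And>k. a k \<notin> pverts (net (s k))"
    and b_fresh: "\<And>k. b k \<notin> pverts (net (s k))"
    and a_neq_b: "\<And>k. a k \<noteq> b k"
begin

abbreviation network :: "nat \<Rightarrow> 'v pair_pre_digraph" where
  "network k \<equiv> net (s k)"

lemma half_A_eq: "half_A (s k) = map a [0..<k]"
  and half_B_eq: "half_B (s k) = map b [0..<k]"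
  by (induction k) (auto simp: start step empty_state_def arrive_def Let_def)

lemma pverts_eq: "pverts (network k) = a ` {..<k} \<union> b ` {..<k}"
  by (induction k) (auto simp: start step empty_state_def arrive_def Let_def lessThan_Suc)

lemma inj_a: "inj a"
proof (rule linorder_injI)
  fix i j :: nat assume "i < j"
  then show "a i \<noteq> a j" by (metis UnI1 a_fresh imageI lessThan_iff pverts_eq)
qed

lemma inj_b: "inj b"
proof (rule linorder_injI)
  fix i j :: nat assume "i < j"
  then show "b i \<noteq> b j" by (metis UnI2 b_fresh imageI lessThan_iff pverts_eq)
qed

text \<open>The later arrival is fresh for a network that already contains the other node.\<close>

lemma a_neq_b': "a i \<noteq> b j"
proof (cases i j rule: linorder_cases)
  case less
  then show ?thesis by (metis UnI1 b_fresh imageI lessThan_iff pverts_eq)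
next
  case equal
  then show ?thesis using a_neq_b by simp
next
  case greater
  then show ?thesis by (metis UnI2 a_fresh imageI lessThan_iff pverts_eq)
qed

lemma hd_map_upt: "hd (map f [0..<k] @ [f k]) = f 0"
  by (cases k) (auto simp: upt_conv_Cons simp del: upt_Suc)

lemma parcs_Suc:
  "parcs (network (Suc k)) = parcs (network k)
     \<union> (\<Union>i<k. link (a k) (a i)) \<union> (\<Union>i<k. link (b k) (b i))
     \<union> link (a k) (b k) \<union> link (a k) (b 0) \<union> link (b k) (a 0)"
proof -
  \<comment> \<open>By injectivity, removing the new node removes no earlier arrival.\<close>
  have "set (map a [0..<k] @ [a k]) - {a k} = a ` {..<k}"
    "set (map b [0..<k] @ [b k]) - {b k} = b ` {..<k}"
    using inj_a inj_b by (auto simp: inj_eq)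
  then show ?thesis
    by (simp only: step arrive_def Let_def half_A_eq half_B_eq hd_map_upt) simp
qed

lemma parcs_0: "parcs (network 0) = {}"
  by (simp add: start empty_state_def)

lemma parcs_mono: "i \<le> j \<Longrightarrow> parcs (network i) \<subseteq> parcs (network j)"
  by (induction rule: dec_induct) (auto simp: parcs_Suc)

lemma card_pverts: "card (pverts (network k)) = 2 * k"
proof -
  have "a ` {..<k} \<inter> b ` {..<k} = {}" using a_neq_b' by blast
  then show ?thesis
    by (simp add: pverts_eq card_Un_disjoint card_image inj_on_subset[OF inj_a subset_UNIV]
        inj_on_subset[OF inj_b subset_UNIV])
qed

text \<open>One induction supplies every axiom of \<open>pair_graph\<close> other than
  finiteness.\<close>

lemma arc_ends: "(u, v) \<in> parcs (network k) \<Longrightarrow>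
    u \<in> pverts (network k) \<and> v \<in> pverts (network k) \<and> u \<noteq> v \<and> (v, u) \<in> parcs (network k)"
proof (induction k)
  case 0
  then show ?case by (simp add: parcs_0)
next
  case (Suc k)
  show ?case
  proof (cases "(u, v) \<in> parcs (network k)")
    case True
    with Suc.IH show ?thesis by (auto simp: parcs_Suc pverts_eq lessThan_Suc)
  next
    case False
    with Suc.prems show ?thesis
      using a_neq_b' a_neq_b'[symmetric] inj_a inj_b
      by (auto simp: parcs_Suc pverts_eq link_def inj_eq less_Suc_eq)
  qed
qed

lemma finite_parcs: "finite (parcs (network k))"
  by (induction k) (auto simp: parcs_0 parcs_Suc link_def)

lemma arc_sym: "(u, v) \<in> parcs (network k) \<Longrightarrow> (v, u) \<in> parcs (network k)"
  using arc_ends by blast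

lemma pair_graph_network: "pair_graph (network k)"
proof unfold_locales
  show "finite (pverts (network k))" by (simp add: pverts_eq)
  show "finite (parcs (network k))" by (rule finite_parcs)
  show "symmetric (with_proj (network k))"
    by (auto simp only: symmetric_def with_proj_simps intro!: symI dest: arc_sym)
  fix e assume "e \<in> parcs (network k)"
  then show "fst e \<in> pverts (network k)" "snd e \<in> pverts (network k)" "fst e \<noteq> snd e"
    using arc_ends[of "fst e" "snd e" k] by simp_all
qed

text \<open>The later of the two nodes creates the link on arrival, and links persist; by symmetry
  \<open>i\<close> may be taken as the earlier one.\<close>

lemma arc_a: assumes "i < k" "j < k" "i \<noteq> j" shows "(a i, a j) \<in> parcs (network k)"
  using assms
proof (induction i j rule: linorder_wlog)
  case (le i j)
  then have "(a i, a j) \<in> parcs (network (Suc j))" by (auto simp: parcs_Suc link_def)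
  then show ?case using parcs_mono[of "Suc j" k] le by auto
next
  case (sym i j)
  then show ?case by (simp add: arc_sym)
qed

lemma arc_b: assumes "i < k" "j < k" "i \<noteq> j" shows "(b i, b j) \<in> parcs (network k)"
  using assms
proof (induction i j rule: linorder_wlog)
  case (le i j)
  then have "(b i, b j) \<in> parcs (network (Suc j))" by (auto simp: parcs_Suc link_def)
  then show ?case using parcs_mono[of "Suc j" k] le by auto
next
  case (sym i j)
  then show ?case by (simp add: arc_sym)
qed

text \<open>All three arcs exist from step \<open>i + 1\<close> on. They are oriented from
  \<open>A\<close> to \<open>B\<close>, as the bridge in \<open>connected_two_cliques\<close>
  is.\<close>

lemma arc_cross:
  assumes "i < k"
  shows "(a i, b i) \<in> parcs (network k)" "(a i, b 0) \<in> parcs (network k)"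
    "(a 0, b i) \<in> parcs (network k)"
proof -
  have "parcs (network (Suc i)) \<subseteq> parcs (network k)" using assms by (intro parcs_mono) simp
  then show "(a i, b i) \<in> parcs (network k)" "(a i, b 0) \<in> parcs (network k)"
    "(a 0, b i) \<in> parcs (network k)"
    by (auto simp: parcs_Suc link_def)
qed

lemma robust_network:
  assumes "k \<ge> 1"
  shows "robust k (network k)"
  unfolding robust_def
proof (intro allI impI)
  fix S assume S: "S \<subseteq> pverts (network k)" "card S = k"
  \<comment> \<open>\<open>I\<close> and \<open>J\<close> are the indices of the survivors in the
    two halves; a common index is a surviving pair.\<close>
  define I where "I = {i. i < k \<and> a i \<notin> S}"
  define J where "J = {i. i < k \<and> b i \<notin> S}"
  have V: "pverts (network k) - S = a ` I \<union> b ` J"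
    by (auto simp: pverts_eq I_def J_def)
  have fin: "finite I" "finite J" by (auto simp: I_def J_def)
  have "finite S" using S(1) by (rule finite_subset) (simp add: pverts_eq)
  then have "card (a ` I \<union> b ` J) = k"
    using S by (simp only: V[symmetric] card_Diff_subset card_pverts)
  moreover have "a ` I \<inter> b ` J = {}" using a_neq_b' by blast
  ultimately have IJ: "card I + card J = k"
    using fin by (simp add: card_Un_disjoint card_image inj_on_subset[OF inj_a subset_UNIV]
        inj_on_subset[OF inj_b subset_UNIV])
  have "\<exists>i\<in>I. \<exists>j\<in>J. (a i, b j) \<in> parcs (network k)" if ne: "I \<noteq> {}" "J \<noteq> {}"
  proof (cases "I \<inter> J = {}")
    case False
    then show ?thesis using arc_cross(1) by (auto simp: I_def)
  next
    case True
    \<comment> \<open>Disjoint sets of indices below \<open>k\<close> whose sizes add up to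
      \<open>k\<close> exhaust them, so index 0 survives in one half.\<close>
    then have "card (I \<union> J) = card {..<k}" using IJ fin by (simp add: card_Un_disjoint)
    moreover have "I \<union> J \<subseteq> {..<k}" by (auto simp: I_def J_def)
    ultimately have IJ_eq: "I \<union> J = {..<k}" by (intro card_subset_eq) auto
    have "0 \<in> {..<k}" using assms by simp
    then have "0 \<in> I \<or> 0 \<in> J" unfolding IJ_eq[symmetric] by blast
    then show ?thesis
    proof
      assume "0 \<in> I"
      moreover obtain j where "j \<in> J" using ne by blast
      ultimately show ?thesis using arc_cross(3)[of j k] by (auto simp: J_def)
    next
      assume "0 \<in> J"
      moreover obtain i where "i \<in> I" using ne by blast
      ultimately show ?thesis using arc_cross(2)[of i k] by (auto simp: I_def)
    qed
  qed
  moreover have "a ` I \<union> b ` J \<noteq> {}" using IJ assms by auto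
  moreover have "pair_wf_digraph (network k)"
    using pair_graph_network[of k] by (simp add: pair_graph.axioms pair_digraph.pair_wf_digraph)
  ultimately show "Digraph_Component.connected (with_proj (network k) \<restriction> (pverts (network k) - S))"
    unfolding V by (intro connected_two_cliques) (auto simp: I_def J_def intro: arc_a arc_b)
qed

text \<open>The 2 stands on the left to avoid truncated subtraction. The right side grows by
  \<open>2 * k + 3\<close> per step, exactly the allowance for new links. The induction starts at 1,
  with equality there, since the inequality fails at 0.\<close>

lemma card_links: "k \<ge> 1 \<Longrightarrow> card (links (network k)) + 2 \<le> k\<^sup>2 + 2 * k"
proof (induction rule: nat_induct_at_least)
  case base
  have "links (network 1) \<subseteq> {{a 0, b 0}}"
    using parcs_Suc[of 0] by (auto simp: links_def parcs_0 link_def)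
  then have "card (links (network 1)) \<le> card {{a 0, b 0}}" by (intro card_mono) auto
  then show ?case by simp
next
  case (Suc k)
  let ?A = "(\<lambda>i. {a k, a i}) ` {..<k}" and ?B = "(\<lambda>i. {b k, b i}) ` {..<k}"
  let ?C = "{{a k, b k}, {a k, b 0}, {b k, a 0}}"
  \<comment> \<open>Only upper bounds are needed, so the new links need not be shown
    distinct.\<close>
  have "links (network (Suc k)) \<subseteq> links (network k) \<union> (?A \<union> (?B \<union> ?C))"
    unfolding links_def parcs_Suc by (auto simp: link_def)
  then have "card (links (network (Suc k))) \<le> card (links (network k) \<union> (?A \<union> (?B \<union> ?C)))"
    by (intro card_mono) (auto simp: finite_links finite_parcs)
  also have "\<dots> \<le> card (links (network k)) + (card ?A + (card ?B + card ?C))"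
    by (meson add_left_mono card_Un_le order_trans)
  also have "\<dots> \<le> card (links (network k)) + (k + (k + 3))"
    by (intro add_mono order_refl order_trans[OF card_image_le]) (auto simp: card_insert_if)
  finally show ?case using Suc.IH by (simp add: power2_eq_square)
qed

end

text \<open>Choice turns the arrivals of the separate steps into two sequences, with step
  \<open>k\<close> reindexed as \<open>Suc k\<close>.\<close>

lemma network_growth_run:
  assumes "network_growth s"
  obtains a b where "growth_run s a b"
proof -
  have "\<forall>k. \<exists>x y. x \<notin> pverts (net (s k)) \<and> y \<notin> pverts (net (s k)) \<and> x \<noteq> y \<and>
      s (Suc k) = arrive x y (s k)"
  proof
    fix k
    show "\<exists>x y. x \<notin> pverts (net (s k)) \<and> y \<notin> pverts (net (s k)) \<and> x \<noteq> y \<and>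
      s (Suc k) = arrive x y (s k)"
      using assms[unfolded network_growth_def, THEN conjunct2, rule_format, of "Suc k"] by simp
  qed
  then obtain a b where "\<forall>k. a k \<notin> pverts (net (s k)) \<and> b k \<notin> pverts (net (s k)) \<and> a k \<noteq> b k \<and>
      s (Suc k) = arrive (a k) (b k) (s k)"
    by metis
  with assms have "growth_run s a b"
    unfolding growth_run_def network_growth_def by blast
  then show thesis by (rule that)
qed

theorem theorem9:
  fixes s :: "nat \<Rightarrow> 'v growth_state"
    and G :: "nat \<Rightarrow> 'v pair_pre_digraph"
    and N L :: "nat \<Rightarrow> nat"
  assumes growth: "network_growth s"
    and G: "\<And>k. G k = net (s k)"
    and N: "\<And>k. N k = card (pverts (G k))"
    and L: "\<And>k. L k = card (links (G k))"
  shows "(\<forall>k. pair_graph (G k) \<and> N k = 2 * k) \<and>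
         (\<forall>i j. i \<le> j \<longrightarrow> subgraph (with_proj (G i)) (with_proj (G j))) \<and>
         (\<forall>k \<ge> 1. robust (N k div 2) (G k) \<and>
                  real (L k) \<le> (real (N k))\<^sup>2 / 4 + real (N k) - 2)"
proof -
  obtain a b where "growth_run s a b" using growth by (rule network_growth_run)
  then interpret growth_run s a b .
  have N2: "N k = 2 * k" for k by (simp add: N G card_pverts)
  have wf: "wf_digraph (with_proj (G k))" for k
    using pair_graph_network[of k] unfolding wf_digraph_wp_iff G
    by (simp add: pair_graph.axioms pair_digraph.pair_wf_digraph)
  have "subgraph (with_proj (G i)) (with_proj (G j))" if "i \<le> j" for i j
    unfolding subgraph_def using that wf parcs_mono[OF that]
    by (auto simp: G pverts_eq)
  moreover have "real (L k) \<le> (real (N k))\<^sup>2 / 4 + real (N k) - 2" if "k \<ge> 1" for k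
  proof -
    \<comment> \<open>The bound passes to the reals before the 2 is subtracted; with
      \<open>N k = 2 * k\<close>, the square of \<open>N k\<close> over 4 is the square of
      \<open>k\<close>.\<close>
    have "real (L k + 2) \<le> real (k\<^sup>2 + 2 * k)"
      using card_links[OF that] unfolding L G by (rule of_nat_mono)
    then show ?thesis by (simp add: N2 power2_eq_square)
  qed
  ultimately show ?thesis
    using robust_network pair_graph_network by (simp add: N2 G)
qed

end
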